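(* Let $(S,\cdot)$ be a semigroup satisfying the Strong F\o lner Condition and let $\langle F_\alpha\rangle_{\alpha\in D}$ be a F\o lner net in ${\mathcal P}_f(S)$. Then for all $A\subseteq S$, $$d(A)=d^*(A)=d_t(A)=\lim_{\alpha\in D}\max_{s\in S}\frac{|As^{-1}\cap F_\alpha|}{|F_\alpha|}.$$
   Context: ${\mathcal P}_f(S)$ is the set of finite nonempty subsets of $S$; $As^{-1}=\{y\in S:ys\in A\}$. A F\o lner net in ${\mathcal P}_f(S)$ is a net $\langle F_\alpha\rangle_{\alpha\in D}$ with $\lim_{\alpha}|F_\alpha\setminus sF_\alpha|/|F_\alpha|=0$ for every $s\in S$. $S$ satisfies the Strong F\o lner Condition if for every $H\in{\mathcal P}_f(S)$, $\epsilon>0$ there is $K\in{\mathcal P}_f(S)$ with $|K\setminus sK|<\epsilon|K|$ for all $s\in H$. $d(A)$ is the supremum of $\alpha\in[0,1]$ such that for every $H\in{\mathcal P}_f(S)$ and $\epsilon>0$ there is $K\in{\mathcal P}_f(S)$ with $|K\setminus sK|<\epsilon|K|$ for all $s\in H$ and $|A\cap K|\ge\alpha|K|$. A mean on $S$ is a continuous linear functional $\mu$ on $l_\infty(S)$ (bounded real functions, sup norm) with $\|\mu\|=1$ and $\mu\ge0$ on nonnegative functions; it is left invariant if $\mu(g\circ\lambda_s)=\mu(g)$ for all $s$, where $\lambda_s(y)=sy$; $LIM(S)$ is the set of left invariant means; $d^*(A)=\sup\{\lambda(\chi_A):\lambda\in LIM(S)\}$. $d_t(A)=\sup\{\alpha\in[0,1]:$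 for every $F\in{\mathcal P}_f(S)$ there is $s\in S$ with $|F\cap As^{-1}|\ge\alpha|F|\}$. *)

theory Defs
  imports "HOL-Probability.Discrete_Topology"
begin

section \<open>Nets\<close>

definition directed_set :: "'d set \<Rightarrow> ('d \<Rightarrow> 'd \<Rightarrow> bool) \<Rightarrow> bool" where
  "directed_set D le \<longleftrightarrow>
     D \<noteq> {} \<and> reflp_on D le \<and> transp_on D le \<and>
     (\<forall>a\<in>D. \<forall>b\<in>D. \<exists>c\<in>D. le a c \<and> le b c)"

text \<open>The filter of tails: a net indexed by \<open>D\<close> converges to \<open>l\<close> iff it tends to \<open>l\<close> along this filter.\<close>

definition net_filter :: "'d set \<Rightarrow> ('d \<Rightarrow> 'd \<Rightarrow> bool) \<Rightarrow> 'd filter" where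
  "net_filter D le = (INF a\<in>D. principal {b\<in>D. le a b})"

lemma eventually_net_filter:
  assumes "directed_set D le"
  shows "eventually P (net_filter D le) \<longleftrightarrow> (\<exists>a\<in>D. \<forall>b\<in>D. le a b \<longrightarrow> P b)"
proof -
  have "\<exists>x\<in>D. principal {b\<in>D. le x b} \<le> inf (principal {c\<in>D. le a c}) (principal {c\<in>D. le b c})"
    if ab: "a \<in> D" "b \<in> D" for a b
  proof -
    obtain c where c: "c \<in> D" "le a c" "le b c"
      using assms ab unfolding directed_set_def by blast
    have "le a e \<and> le b e" if "e \<in> D" "le c e" for e
      using assms ab c that unfolding directed_set_def by (meson transp_onD)
    then show ?thesis
      using c(1) by (intro bexI[of _ c]) auto
  qed
  moreover have "D \<noteq> {}"
    using assms by (simp add: directed_set_def)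
  ultimately have "eventually P (net_filter D le) \<longleftrightarrow>
      (\<exists>a\<in>D. eventually P (principal {b\<in>D. le a b}))"
    unfolding net_filter_def by (intro eventually_INF_base) auto
  then show ?thesis
    by (auto simp: eventually_principal Ball_def)
qed

lemma net_filter_neq_bot:
  assumes "directed_set D le"
  shows "net_filter D le \<noteq> bot"
proof -
  have "\<not> eventually (\<lambda>_. False) (net_filter D le)"
    using assms unfolding eventually_net_filter[OF assms] directed_set_def by (meson reflp_onD)
  then show ?thesis
    by auto
qed

section \<open>Strong F{\o}lner Condition and F{\o}lner nets\<close>

definition strong_folner_condition :: "'a::semigroup_mult itself \<Rightarrow> bool" where
  "strong_folner_condition (_ :: 'a itself) \<longleftrightarrow>
     (\<forall>H::'a set. \<forall>\<epsilon>>0. finite H \<and> H \<noteq> {} \<longrightarrow>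
       (\<exists>K. finite K \<and> K \<noteq> {} \<and>
          (\<forall>s\<in>H. real (card (K - (*) s ` K)) < \<epsilon> * real (card K))))"

definition folner_net ::
  "'d set \<Rightarrow> ('d \<Rightarrow> 'd \<Rightarrow> bool) \<Rightarrow> ('d \<Rightarrow> 'a::semigroup_mult set) \<Rightarrow> bool" where
  "folner_net D le F \<longleftrightarrow>
     directed_set D le \<and> (\<forall>\<alpha>\<in>D. finite (F \<alpha>) \<and> F \<alpha> \<noteq> {}) \<and>
     (\<forall>s. ((\<lambda>\<alpha>. real (card (F \<alpha> - (*) s ` F \<alpha>)) / real (card (F \<alpha>))) \<longlongrightarrow> 0) (net_filter D le))"

section \<open>Densities\<close>

text \<open>\<open>right_quotient A s\<close> is $A s^{-1}$.\<close>

definition right_quotient :: "'a::semigroup_mult set \<Rightarrow> 'a \<Rightarrow> 'a set" where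
  "right_quotient A s = {y. y * s \<in> A}"

definition folner_density :: "'a::semigroup_mult set \<Rightarrow> real" where
  "folner_density A = Sup {\<alpha>\<in>{0..1}.
     \<forall>H. \<forall>\<epsilon>>0. finite H \<and> H \<noteq> {} \<longrightarrow>
       (\<exists>K. finite K \<and> K \<noteq> {} \<and>
          (\<forall>s\<in>H. real (card (K - (*) s ` K)) < \<epsilon> * real (card K)) \<and>
          real (card (A \<inter> K)) \<ge> \<alpha> * real (card K))}"

definition translate_density :: "'a::semigroup_mult set \<Rightarrow> real" where
  "translate_density A = Sup {\<alpha>\<in>{0..1}.
     \<forall>F. finite F \<and> F \<noteq> {} \<longrightarrow>
       (\<exists>s. real (card (F \<inter> right_quotient A s)) \<ge> \<alpha> * real (card F))}"

section \<open>Left invariant means\<close>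

text \<open>
  $l_\infty(S)$ is the Banach space of bounded continuous real functions on \<open>S\<close> with the discrete
  topology; continuity is then no restriction.
\<close>

type_synonym 'a linf = "'a discrete \<Rightarrow>\<^sub>C real"

lemma bcontfun_discrete_iff: "(f :: 'a discrete \<Rightarrow> real) \<in> bcontfun \<longleftrightarrow> bounded (range f)"
  by (simp add: bcontfun_def continuous_on_open_vimage open_discrete)

context
  includes bcontfun.lifting
begin

lift_definition left_translate :: "'a::semigroup_mult \<Rightarrow> 'a linf \<Rightarrow> 'a linf" is
  "\<lambda>s g x. g (discrete (s * of_discrete x))"
  unfolding bcontfun_discrete_iff by (erule bounded_subset) auto

lift_definition char_fun :: "'a set \<Rightarrow> 'a linf" is
  "\<lambda>A x. indicator A (of_discrete x)"
  unfolding bcontfun_discrete_iff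
  by (rule bounded_subset[of "{0, 1}"]) (auto simp: indicator_def)

end

definition is_mean :: "('a linf \<Rightarrow> real) \<Rightarrow> bool" where
  "is_mean \<mu> \<longleftrightarrow>
     bounded_linear \<mu> \<and> onorm \<mu> = 1 \<and>
     (\<forall>g. (\<forall>x. 0 \<le> apply_bcontfun g x) \<longrightarrow> 0 \<le> \<mu> g)"

definition left_invariant_means :: "('a::semigroup_mult linf \<Rightarrow> real) set" where
  "left_invariant_means = {\<mu>. is_mean \<mu> \<and> (\<forall>s g. \<mu> (left_translate s g) = \<mu> g)}"

definition mean_density :: "'a::semigroup_mult set \<Rightarrow> real" where
  "mean_density A = (SUP \<mu>\<in>left_invariant_means. \<mu> (char_fun A))"

end

theory Submission
  imports Defs
begin

text \<open>
  Averages over F{\o}lner sets, pushed forward along maps commuting with left translations (the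
  identity or a right translation), cluster at left invariant means; this bounds \<open>d\<close>, \<open>d\<^sub>t\<close> and the
  upper limit of the maxima by \<open>d\<^sup>*\<close>. Averaging \<open>\<chi>\<^sub>A \<circ> \<lambda>\<^sub>f\<close> over \<open>f \<in> F\<close> gives \<open>d\<^sup>* \<le> d\<^sub>t\<close>, and \<open>d\<^sub>t\<close> is
  at most each of the maxima.

  The remaining bound \<open>d\<^sup>* \<le> d\<close> is delicate because right translations may collapse a F{\o}lner set \<open>F\<close>,
  and left translations need not be injective on \<open>F s\<close>. But the Strong F{\o}lner Condition forces
  \<open>f u = g u\<close> for some \<open>u\<close> whenever \<open>t f s = t g s\<close>. Hence for \<open>s\<close> in a suitable right ideal \<open>v S\<close> all left
  translations are injective on \<open>F s\<close>, and averaging over \<open>v S\<close> yields such an \<open>s\<close> with \<open>F s\<close> dense in \<open>A\<close>,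
  counted with multiplicity. The superlevel sets of the multiplicity \<open>x \<mapsto> |{f \<in> F. f s = x}|\<close> are
  then, on average, almost invariant and dense in \<open>A\<close>, so one of them witnesses \<open>d\<close>.
\<close>

section \<open>Almost invariant finite sets under maps that need not be injective\<close>

text \<open>The points that \<open>f\<close> sends into \<open>P\<close> map onto the part of
  \<open>P\<close> inside the image of \<open>K\<close>, and that part misses at most the points of
  \<open>K\<close> outside the image.\<close>

lemma card_not_into_le:
  assumes K: "finite K" and P: "P \<subseteq> K"
  shows "card {x\<in>K. f x \<notin> P} \<le> card (K - f ` K) + card (K - P)"
proof -
  have "P \<inter> f ` K \<subseteq> f ` {x\<in>K. f x \<in> P}"
    by auto
  then have 1: "card (P \<inter> f ` K) \<le> card {x\<in>K. f x \<in> P}"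
    by (rule surj_card_le[rotated]) (use K in simp)
  have "card P \<le> card ((P \<inter> f ` K) \<union> (K - f ` K))"
    using K P by (intro card_mono) (auto intro: finite_subset)
  also have "\<dots> \<le> card (P \<inter> f ` K) + card (K - f ` K)"
    by (rule card_Un_le)
  finally have 2: "card P \<le> card {x\<in>K. f x \<in> P} + card (K - f ` K)"
    using 1 by simp
  have "card K = card ({x\<in>K. f x \<in> P} \<union> {x\<in>K. f x \<notin> P})"
    by (rule arg_cong[where f = card]) auto
  also have "\<dots> = card {x\<in>K. f x \<in> P} + card {x\<in>K. f x \<notin> P}"
    using K by (intro card_Un_disjoint) auto
  finally show ?thesis
    using 2 K P by (simp add: card_Diff_subset finite_subset)
qed

text \<open>One preimage is kept for each value, so the number of discarded points is the size of
  \<open>K\<close> minus that of its image. Almost invariance thus forces near injectivity.\<close>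

lemma inj_on_transversal:
  assumes K: "finite K"
  obtains P where "P \<subseteq> K" "inj_on f P" "f ` P = f ` K" "card (K - P) \<le> card (K - f ` K)"
proof
  let ?P = "inv_into K f ` f ` K"
  show P: "?P \<subseteq> K"
    by (auto intro: inv_into_into)
  show "inj_on f ?P"
    by (rule inj_onI) (auto simp: f_inv_into_f)
  show "f ` ?P = f ` K"
    by (simp add: image_image f_inv_into_f cong: image_cong_simp)
  have "card ?P = card (f ` K)"
    by (rule card_image) (rule inj_on_inv_into, simp)
  moreover have "card K - card (f ` K) \<le> card (K - f ` K)"
    using K by (intro diff_card_le_card_Diff) auto
  ultimately show "card (K - ?P) \<le> card (K - f ` K)"
    using P K by (simp add: card_Diff_subset finite_subset)
qed

section \<open>Cancellation and right multiples under the Strong Folner Condition\<close>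

lemma strong_folner_conditionE:
  fixes H :: "'a::semigroup_mult set"
  assumes "strong_folner_condition TYPE('a)" "finite H" "\<epsilon> > 0"
  obtains K where "finite K" "K \<noteq> {}"
    "\<And>s. s \<in> H \<Longrightarrow> real (card (K - (*) s ` K)) < \<epsilon> * real (card K)"
proof -
  \<comment> \<open>The condition speaks of nonempty sets; an arbitrary extra element covers empty
    \<open>H\<close>.\<close>
  have "finite (insert undefined H)" "insert undefined H \<noteq> {}"
    using assms(2) by auto
  then show ?thesis
    using assms(1,3) that unfolding strong_folner_condition_def by (metis insertCI)
qed

text \<open>
  Most points of a F{\o}lner set \<open>K\<close> lie in \<open>s K\<close> and are sent by \<open>f\<close> and by \<open>g\<close> into a transversal
  of \<open>K\<close> on which \<open>t\<close> is injective; at such a point \<open>f\<close> and \<open>g\<close> agree.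
\<close>

lemma strong_folner_left_cancel:
  fixes t :: "'a::semigroup_mult"
  assumes "strong_folner_condition TYPE('a)" and eq: "t * (f * s) = t * (g * s)"
  shows "\<exists>u. f * u = g * u"
proof -
  \<comment> \<open>Five losses must leave a point of \<open>K\<close>: one each for
    \<open>s\<close>, \<open>f\<close> and \<open>g\<close>, and two for \<open>t\<close>, whose
    transversal has to be hit by both \<open>f\<close> and \<open>g\<close>.\<close>
  obtain K where K: "finite K" "K \<noteq> {}"
    and small: "\<And>r. r \<in> {s, f, g, t} \<Longrightarrow> real (card (K - (*) r ` K)) < 1/5 * real (card K)"
    by (rule strong_folner_conditionE[OF assms(1), of "{s, f, g, t}" "1/5"]) auto
  obtain P where P: "P \<subseteq> K" "inj_on ((*) t) P" and cP: "card (K - P) \<le> card (K - (*) t ` K)"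
    using inj_on_transversal[OF K(1)] by metis
  let ?B = "(K - (*) s ` K) \<union> {x\<in>K. f * x \<notin> P} \<union> {x\<in>K. g * x \<notin> P}"
  have "card ?B \<le> card (K - (*) s ` K) + card {x\<in>K. f * x \<notin> P} + card {x\<in>K. g * x \<notin> P}"
    by (meson card_Un_le add_le_mono le_refl order_trans)
  also have "\<dots> \<le> card (K - (*) s ` K) + (card (K - (*) f ` K) + card (K - (*) t ` K))
      + (card (K - (*) g ` K) + card (K - (*) t ` K))"
    using card_not_into_le[OF K(1) P(1), of "(*) f"] card_not_into_le[OF K(1) P(1), of "(*) g"] cP
    by linarith
  finally have "card ?B < card K"
    using small[of s] small[of f] small[of g] small[of t] by simp
  moreover have "finite ?B"
    using K(1) by simp
  ultimately have "\<not> K \<subseteq> ?B"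
    by (meson card_mono leD)
  then obtain x where x: "x \<in> K" "x \<notin> ?B"
    by blast
  then obtain k where k: "x = s * k"
    by auto
  have "t * (f * x) = t * (g * x)"
    using arg_cong[OF eq, of "\<lambda>y. y * k"] by (simp add: k mult.assoc)
  then have "f * x = g * x"
    using x P(2) by (auto dest: inj_onD)
  then show ?thesis ..
qed

text \<open>Two right ideals meet: a set \<open>K\<close> that loses less than half of its points
  under each of \<open>u\<close> and \<open>v\<close> has a point in both images. Right multiples of
  \<open>v\<close> stay multiples of the earlier elements.\<close>

lemma strong_folner_common_multiple:
  fixes U :: "'a::semigroup_mult set"
  assumes "strong_folner_condition TYPE('a)" and "finite U"
  shows "\<exists>v. \<forall>u\<in>U. \<exists>w. v = u * w"
  using assms(2)
proof (induction U)
  case empty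
  then show ?case by simp
next
  case (insert u U)
  then obtain v where v: "\<forall>u\<in>U. \<exists>w. v = u * w"
    by blast
  obtain K where K: "finite K" "K \<noteq> {}"
    and small: "\<And>r. r \<in> {u, v} \<Longrightarrow> real (card (K - (*) r ` K)) < 1/2 * real (card K)"
    by (rule strong_folner_conditionE[OF assms(1), of "{u, v}" "1/2"]) auto
  have "card ((K - (*) u ` K) \<union> (K - (*) v ` K)) \<le> card (K - (*) u ` K) + card (K - (*) v ` K)"
    by (rule card_Un_le)
  also have "\<dots> < card K"
    using small[of u] small[of v] by simp
  finally have "\<not> K \<subseteq> (K - (*) u ` K) \<union> (K - (*) v ` K)"
    using K(1) by (meson card_mono finite_Diff finite_UnI leD)
  then obtain x where x: "x \<in> (*) u ` K" "x \<in> (*) v ` K"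
    by blast
  then obtain y z where "v * y = u * z"
    by (metis imageE)
  then have "\<forall>a\<in>insert u U. \<exists>w. v * y = a * w"
    using v by (metis insert_iff mult.assoc)
  then show ?case ..
qed

text \<open>An equation \<open>f * u = g * u\<close> survives right multiplication, so a common
  right multiple of one chosen equalizer per pair works for all pairs.\<close>

lemma strong_folner_common_equalizer:
  fixes F :: "'a::semigroup_mult set"
  assumes "strong_folner_condition TYPE('a)" and "finite F"
  shows "\<exists>v. \<forall>f\<in>F. \<forall>g\<in>F. (\<exists>u. f * u = g * u) \<longrightarrow> f * v = g * v"
proof -
  \<comment> \<open>For a pair without an equalizer the choice is arbitrary; being a multiple of it
    does no harm.\<close>
  let ?u = "\<lambda>(f, g). SOME u. f * u = g * u"
  obtain v where v: "\<forall>u \<in> ?u ` (F \<times> F). \<exists>w. v = u * w"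
    using strong_folner_common_multiple[OF assms(1), of "?u ` (F \<times> F)"] assms(2) by auto
  have "f * v = g * v" if "f \<in> F" "g \<in> F" "\<exists>u. f * u = g * u" for f g
  proof -
    have eq: "f * ?u (f, g) = g * ?u (f, g)"
      using someI_ex[OF that(3)] by simp
    obtain w where "v = ?u (f, g) * w"
      using v \<open>f \<in> F\<close> \<open>g \<in> F\<close> by blast
    then show ?thesis
      using arg_cong[OF eq, of "\<lambda>y. y * w"] by (simp only: mult.assoc)
  qed
  then show ?thesis
    by blast
qed

section \<open>Multiplicities and their superlevel sets\<close>

lemma sum_card_fibres:
  assumes "finite G" "finite X" "p ` G \<subseteq> X"
  shows "(\<Sum>x\<in>X. card {f\<in>G. p f = x}) = card G"
  using sum.group[OF assms, of "\<lambda>_. 1::nat"] by simp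

text \<open>Layer-cake formula: both sides count the pairs \<open>(j, x)\<close> with
  \<open>j < \<phi> x\<close>.\<close>

lemma sum_card_superlevel:
  fixes \<phi> :: "'b \<Rightarrow> nat"
  assumes X: "finite X" and n: "\<And>x. x \<in> X \<Longrightarrow> \<phi> x \<le> n"
  shows "(\<Sum>j<n. card {x\<in>X. j < \<phi> x}) = (\<Sum>x\<in>X. \<phi> x)"
proof -
  have "(\<Sum>j<n. card {x\<in>X. j < \<phi> x}) = (\<Sum>j<n. \<Sum>x\<in>X. if j < \<phi> x then 1 else 0)"
    using X by (simp add: sum.If_cases Int_def)
  also have "\<dots> = (\<Sum>x\<in>X. \<Sum>j<n. if j < \<phi> x then 1 else 0)"
    by (rule sum.swap)
  also have "\<dots> = (\<Sum>x\<in>X. \<phi> x)"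
  proof (rule sum.cong[OF refl])
    fix x assume "x \<in> X"
    then have "{..<n} \<inter> {j. j < \<phi> x} = {..<\<phi> x}"
      using n by force
    then show "(\<Sum>j<n. if j < \<phi> x then 1 else 0) = \<phi> x"
      by (simp add: sum.If_cases)
  qed
  finally show ?thesis .
qed

text \<open>Summing over levels recovers the count with multiplicity; it is used for
  \<open>B = A\<close> and, to get the total size of the levels, for
  \<open>B = UNIV\<close>.\<close>

lemma sum_card_levels_Int:
  fixes p :: "'a \<Rightarrow> 'b"
  assumes F: "finite F"
  shows "(\<Sum>j<card F. card (B \<inter> {x\<in>p ` F. j < card {f\<in>F. p f = x}})) = card {f\<in>F. p f \<in> B}"
proof -
  let ?X = "B \<inter> p ` F"
  have "(\<Sum>j<card F. card (B \<inter> {x\<in>p ` F. j < card {f\<in>F. p f = x}}))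
      = (\<Sum>j<card F. card {x\<in>?X. j < card {f\<in>F. p f = x}})"
    by (intro sum.cong refl arg_cong[where f = card]) auto
  also have "\<dots> = (\<Sum>x\<in>?X. card {f\<in>F. p f = x})"
    using F by (intro sum_card_superlevel) (auto intro: card_mono)
  also have "\<dots> = (\<Sum>x\<in>?X. card {f\<in>{f\<in>F. p f \<in> B}. p f = x})"
    by (intro sum.cong refl arg_cong[where f = card]) auto
  also have "\<dots> = card {f\<in>F. p f \<in> B}"
    using F by (intro sum_card_fibres) auto
  finally show ?thesis .
qed

text \<open>
  Multiplicities are almost non-decreasing along \<open>t\<close>: if \<open>f = t f'\<close> and \<open>p f = y\<close> then \<open>t (p f') = y\<close>,
  so only the \<open>f \<in> F - t F\<close> contribute to the loss.
\<close>

lemma sum_card_levels_Diff_le: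
  fixes p t :: "'a \<Rightarrow> 'a"
  assumes F: "finite F" and comm: "\<And>f. p (t f) = t (p f)"
    and inj: "inj_on t (p ` F)"
  defines "K \<equiv> \<lambda>j. {x\<in>p ` F. j < card {f\<in>F. p f = x}}"
  shows "(\<Sum>j<card F. card (K j - t ` K j)) \<le> card (F - t ` F)"
proof -
  let ?\<phi> = "\<lambda>x. card {f\<in>F. p f = x}" and ?\<psi> = "\<lambda>x. card {f\<in>F. t (p f) = x}"
  let ?\<delta> = "\<lambda>x. card {f\<in>F - t ` F. p f = x}"
  \<comment> \<open>Injectivity of \<open>t\<close> on the image of \<open>p\<close> gives
    \<open>?\<psi> (t x) = ?\<phi> x\<close> for \<open>x\<close> there, so a point where
    \<open>?\<psi>\<close> exceeds \<open>j\<close> is the \<open>t\<close>-image of a point of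
    \<open>K j\<close>.\<close>
  have sub: "K j - t ` K j \<subseteq> {x\<in>p ` F. ?\<psi> x \<le> j \<and> j < ?\<phi> x}" for j
  proof safe
    fix y assume y: "y \<in> K j" "y \<notin> t ` K j"
    show "y \<in> p ` F" "j < ?\<phi> y"
      using y(1) by (auto simp: K_def)
    show "?\<psi> y \<le> j"
    proof (rule ccontr)
      assume *: "\<not> ?\<psi> y \<le> j"
      then have "{f\<in>F. t (p f) = y} \<noteq> {}"
        by fastforce
      then obtain f where f: "f \<in> F" "t (p f) = y"
        by blast
      then have "{f'\<in>F. t (p f') = y} = {f'\<in>F. p f' = p f}"
        using inj by (auto dest: inj_onD)
      then have "p f \<in> K j"
        using * f by (auto simp: K_def)
      then show False
        using y(2) f(2) by blast
    qed
  qed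
  have le: "?\<phi> x \<le> ?\<psi> x + ?\<delta> x" for x
  proof -
    have "{f\<in>F \<inter> t ` F. p f = x} \<subseteq> t ` {f\<in>F. t (p f) = x}"
      using comm by auto
    then have "card {f\<in>F \<inter> t ` F. p f = x} \<le> ?\<psi> x"
      by (rule surj_card_le[rotated]) (use F in simp)
    moreover have "?\<phi> x \<le> card {f\<in>F \<inter> t ` F. p f = x} + ?\<delta> x"
      by (rule order_trans[OF card_mono card_Un_le]) (use F in auto)
    ultimately show ?thesis
      by simp
  qed
  have "(\<Sum>j<card F. card (K j - t ` K j))
      \<le> (\<Sum>j<card F. card {x\<in>p ` F. ?\<psi> x \<le> j \<and> j < ?\<phi> x})"
    using F sub by (intro sum_mono card_mono) auto
  also have "\<dots> = (\<Sum>j<card F. \<Sum>x\<in>p ` F. if ?\<psi> x \<le> j \<and> j < ?\<phi> x then 1 else 0)"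
    using F by (simp add: sum.If_cases Int_def)
  also have "\<dots> = (\<Sum>x\<in>p ` F. \<Sum>j<card F. if ?\<psi> x \<le> j \<and> j < ?\<phi> x then 1 else 0)"
    by (rule sum.swap)
  also have "\<dots> = (\<Sum>x\<in>p ` F. card {j\<in>{..<card F}. ?\<psi> x \<le> j \<and> j < ?\<phi> x})"
    by (simp add: sum.If_cases Int_def)
  also have "\<dots> \<le> (\<Sum>x\<in>p ` F. ?\<delta> x)"
  proof (rule sum_mono)
    fix x
    \<comment> \<open>The levels at which \<open>x\<close> is lost lie in an interval whose length
      is at most \<open>?\<delta> x\<close> by \<open>le\<close>.\<close>
    have "card {j\<in>{..<card F}. ?\<psi> x \<le> j \<and> j < ?\<phi> x} \<le> card {?\<psi> x..<?\<phi> x}"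
      by (intro card_mono) auto
    then show "card {j\<in>{..<card F}. ?\<psi> x \<le> j \<and> j < ?\<phi> x} \<le> ?\<delta> x"
      using le[of x] by simp
  qed
  also have "\<dots> = card (F - t ` F)"
    using F by (intro sum_card_fibres) auto
  finally show ?thesis .
qed

section \<open>From left invariant means to translates and Folner sets dense in
  \<open>A\<close>\<close>

lemma apply_bcontfun_sum: "apply_bcontfun (\<Sum>i\<in>I. f i) x = (\<Sum>i\<in>I. apply_bcontfun (f i) x)"
  by (induction I rule: infinite_finite_induct) auto

text \<open>Positivity compares \<open>g\<close> with the constant \<open>c\<close>, and
  \<open>onorm \<mu> = 1\<close> bounds the value at that constant by its norm, which is at most
  \<open>c\<close> because \<open>0 \<le> c\<close>.\<close>

lemma is_mean_le:
  assumes \<mu>: "is_mean \<mu>" and le: "\<And>x. apply_bcontfun g x \<le> c" and "0 \<le> c"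
  shows "\<mu> g \<le> c"
proof -
  have lin: "bounded_linear \<mu>" and norm: "onorm \<mu> = 1"
    using \<mu> by (auto simp: is_mean_def)
  have "0 \<le> \<mu> (const_bcontfun c - g)"
    using \<mu> le by (simp add: is_mean_def)
  then have "\<mu> g \<le> \<mu> (const_bcontfun c)"
    by (simp add: linear_diff[OF bounded_linear.linear[OF lin]])
  also have "\<dots> \<le> norm (const_bcontfun c :: 'a linf)"
    using onorm[OF lin, of "const_bcontfun c"] by (simp add: norm)
  also have "\<dots> \<le> c"
    using \<open>0 \<le> c\<close> by (intro norm_bound) simp
  finally show ?thesis .
qed

text \<open>The sum of the translates of \<open>char_fun A\<close> by \<open>h f\<close> has mean
  \<open>\<mu> (char_fun A) * card F\<close> and value \<open>?n w\<close> at \<open>w\<close>. As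
  \<open>?n\<close> takes finitely many values, its maximum is attained and dominates the
  mean.\<close>

lemma left_invariant_mean_ex_translate:
  fixes h :: "'b \<Rightarrow> 'a::semigroup_mult"
  assumes \<mu>: "\<mu> \<in> left_invariant_means" and F: "finite F"
  shows "\<exists>w. \<mu> (char_fun A) * real (card F) \<le> real (card {f\<in>F. h f * w \<in> A})"
proof -
  let ?n = "\<lambda>w. card {f\<in>F. h f * w \<in> A}"
  let ?g = "\<Sum>f\<in>F. left_translate (h f) (char_fun A)"
  have mean: "is_mean \<mu>" and inv: "\<mu> (left_translate s g) = \<mu> g" for s g
    using \<mu> by (auto simp: left_invariant_means_def)
  have "range ?n \<subseteq> {..card F}"
    using F by (auto intro: card_mono)
  then have fin: "finite (range ?n)"
    by (rule finite_subset) simp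
  have "apply_bcontfun ?g x = real (?n (of_discrete x))" for x
    using F
    by (simp add: apply_bcontfun_sum left_translate.rep_eq char_fun.rep_eq discrete_inverse
        indicator_def sum.If_cases Int_def)
  then have "apply_bcontfun ?g x \<le> real (Max (range ?n))" for x
    using fin by simp
  then have "\<mu> ?g \<le> real (Max (range ?n))"
    by (intro is_mean_le[OF mean]) auto
  moreover have "\<mu> ?g = \<mu> (char_fun A) * real (card F)"
    using mean by (simp add: is_mean_def linear_sum[OF bounded_linear.linear] inv)
  moreover have "Max (range ?n) \<in> range ?n"
    using fin by (intro Max_in) auto
  ultimately show ?thesis
    by auto
qed

lemma folner_set_of_mean:
  fixes A H :: "'a::semigroup_mult set"
  assumes sfc: "strong_folner_condition TYPE('a)" and \<mu>: "\<mu> \<in> left_invariant_means"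
    and c: "0 \<le> c" "c < \<mu> (char_fun A)" and H: "finite H" and "\<epsilon> > 0"
  shows "\<exists>K. finite K \<and> K \<noteq> {} \<and> (\<forall>s\<in>H. real (card (K - (*) s ` K)) < \<epsilon> * real (card K)) \<and>
    c * real (card K) \<le> real (card (A \<inter> K))"
proof (rule ccontr)
  assume no: "\<not> ?thesis"
  define a where "a = \<mu> (char_fun A)"
  \<comment> \<open>The summand 1 makes \<open>\<delta> * card H\<close> strictly less than
    \<open>\<epsilon> * (a - c)\<close> and allows empty \<open>H\<close>.\<close>
  define \<delta> where "\<delta> = \<epsilon> * (a - c) / (card H + 1)"
  have "\<delta> > 0"
    using c \<open>\<epsilon> > 0\<close> by (simp add: \<delta>_def a_def)
  have "\<delta> * (real (card H) + 1) = \<epsilon> * (a - c)"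
    by (simp add: \<delta>_def add.commute)
  then have Hd: "\<delta> * real (card H) < \<epsilon> * (a - c)"
    using \<open>\<delta> > 0\<close> unfolding distrib_left by linarith
  obtain F where F: "finite F" "F \<noteq> {}"
    and small: "\<And>t. t \<in> H \<Longrightarrow> real (card (F - (*) t ` F)) < \<delta> * real (card F)"
    by (rule strong_folner_conditionE[OF sfc H \<open>\<delta> > 0\<close>]) auto
  \<comment> \<open>Fixing \<open>v\<close> before \<open>w\<close> makes the injectivity below hold
    for whatever \<open>w\<close> the mean provides.\<close>
  obtain v where v: "\<And>f g u. f \<in> F \<Longrightarrow> g \<in> F \<Longrightarrow> f * u = g * u \<Longrightarrow> f * v = g * v"
    using strong_folner_common_equalizer[OF sfc F(1)] by blast
  obtain w where w: "a * real (card F) \<le> real (card {f\<in>F. f * v * w \<in> A})"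
    using left_invariant_mean_ex_translate[OF \<mu> F(1), of A "\<lambda>f. f * v"] by (auto simp: a_def)
  define p where "p = (\<lambda>f. f * v * w)"
  define K where "K = (\<lambda>j. {x\<in>p ` F. j < card {f\<in>F. p f = x}})"
  \<comment> \<open>Cancelling \<open>t\<close> with \<open>s = v * w\<close> yields some
    \<open>u\<close> with \<open>f * u = g * u\<close>, which \<open>v\<close> turns into
    \<open>f * v = g * v\<close>.\<close>
  have inj: "inj_on ((*) t) (p ` F)" for t
  proof (rule inj_onI, clarify)
    fix f g assume fg: "f \<in> F" "g \<in> F" "t * p f = t * p g"
    then obtain u where "f * u = g * u"
      using strong_folner_left_cancel[OF sfc, of t f "v * w" g] by (auto simp: p_def mult.assoc)
    then have "f * v = g * v"
      by (rule v[OF fg(1,2)])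
    then show "p f = p g"
      by (simp add: p_def)
  qed
  have finK: "finite (K j)" for j
    using F by (simp add: K_def)
  \<comment> \<open>Either some \<open>t\<close> in \<open>H\<close> moves so much of
    \<open>K j\<close> that the error term alone exceeds \<open>card (K j)\<close>, or
    \<open>K j\<close> is almost invariant and, by \<open>no\<close>, has density below
    \<open>c\<close> unless it is empty.\<close>
  have level: "real (card (A \<inter> K j)) \<le> c * card (K j) + (\<Sum>t\<in>H. real (card (K j - (*) t ` K j))) / \<epsilon>" for j
  proof (cases "\<exists>t\<in>H. \<epsilon> * real (card (K j)) \<le> real (card (K j - (*) t ` K j))")
    case True
    then obtain t where t: "t \<in> H" "\<epsilon> * real (card (K j)) \<le> real (card (K j - (*) t ` K j))"
      by blast
    have "real (card (A \<inter> K j)) \<le> real (card (K j))"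
      using finK by (simp add: card_mono)
    also have "\<dots> \<le> real (card (K j - (*) t ` K j)) / \<epsilon>"
      using t \<open>\<epsilon> > 0\<close> by (simp add: field_simps)
    also have "\<dots> \<le> (\<Sum>t\<in>H. real (card (K j - (*) t ` K j))) / \<epsilon>"
      using t H \<open>\<epsilon> > 0\<close> by (intro divide_right_mono member_le_sum) auto
    also have "\<dots> \<le> c * card (K j) + \<dots>"
      using c by simp
    finally show ?thesis .
  next
    case False
    have "real (card (A \<inter> K j)) \<le> c * card (K j)"
    proof (cases "K j = {}")
      case False
      then show ?thesis
        using no \<open>\<not> (\<exists>t\<in>H. \<epsilon> * _ \<le> _)\<close> finK[of j] by (meson not_le less_imp_le)
    qed simp
    also have "\<dots> \<le> \<dots> + (\<Sum>t\<in>H. real (card (K j - (*) t ` K j))) / \<epsilon>"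
      using \<open>\<epsilon> > 0\<close> by (simp add: sum_nonneg)
    finally show ?thesis .
  qed
  have sumA: "(\<Sum>j<card F. card (A \<inter> K j)) = card {f\<in>F. p f \<in> A}"
    unfolding K_def by (rule sum_card_levels_Int[OF F(1)])
  have sumK: "(\<Sum>j<card F. card (K j)) = card F"
    using sum_card_levels_Int[OF F(1), of UNIV p] by (simp add: K_def)
  have sumD: "(\<Sum>j<card F. card (K j - (*) t ` K j)) \<le> card (F - (*) t ` F)" for t
    unfolding K_def by (rule sum_card_levels_Diff_le[OF F(1) _ inj]) (simp add: p_def mult.assoc)
  \<comment> \<open>Summing \<open>level\<close> over \<open>j\<close> gives
    \<open>a \<le> c + card H * \<delta> / \<epsilon>\<close>, against the choice of
    \<open>\<delta>\<close>.\<close>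
  have "a * real (card F) \<le> real (card {f\<in>F. p f \<in> A})"
    using w by (simp add: p_def)
  also have "\<dots> = (\<Sum>j<card F. real (card (A \<inter> K j)))"
    by (simp flip: sumA)
  also have "\<dots> \<le> (\<Sum>j<card F. c * card (K j) + (\<Sum>t\<in>H. real (card (K j - (*) t ` K j))) / \<epsilon>)"
    by (intro sum_mono level)
  also have "\<dots> = c * real (\<Sum>j<card F. card (K j))
      + (\<Sum>t\<in>H. real (\<Sum>j<card F. card (K j - (*) t ` K j))) / \<epsilon>"
    by (simp add: sum.distrib sum_distrib_left sum.swap[of _ H] flip: sum_divide_distrib)
  also have "\<dots> \<le> c * real (card F) + (\<Sum>t\<in>H. \<delta> * real (card F)) / \<epsilon>"
  proof -
    have "real (\<Sum>j<card F. card (K j - (*) t ` K j)) \<le> \<delta> * real (card F)" if "t \<in> H" for t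
      using sumD[of t] small[OF that] by linarith
    then show ?thesis
      unfolding sumK using \<open>\<epsilon> > 0\<close>
      by (intro add_left_mono divide_right_mono sum_mono) auto
  qed
  also have "\<dots> = (c + real (card H) * \<delta> / \<epsilon>) * real (card F)"
    by (simp add: algebra_simps)
  also have "\<dots> < a * real (card F)"
    using F Hd \<open>\<epsilon> > 0\<close> by (intro mult_strict_right_mono) (auto simp: field_simps card_gt_0_iff)
  finally show False
    by simp
qed

section \<open>From Folner sets to left invariant means\<close>

text \<open>The sum runs over \<open>K\<close> and not over its image, so points are weighted by
  multiplicity and \<open>h\<close> may be a non-injective right translation.\<close>

definition average :: "('a \<Rightarrow> 'b) \<Rightarrow> 'a set \<Rightarrow> 'b linf \<Rightarrow> real" where
  "average h K g = (\<Sum>x\<in>K. apply_bcontfun g (discrete (h x))) / real (card K)"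

text \<open>As \<open>h\<close> commutes with \<open>t\<close>, translating \<open>g\<close> amounts
  to replacing \<open>x\<close> by \<open>t * x\<close>. The terms over a set \<open>P\<close> that
  \<open>t\<close> maps bijectively onto the part of \<open>K\<close> in its image cancel; two
  remainders of equal size are left, with terms bounded by \<open>norm g\<close>.\<close>

lemma average_left_translate_le:
  fixes h :: "'a::semigroup_mult \<Rightarrow> 'a"
  assumes K: "finite K" and h: "\<And>x. h (t * x) = t * h x"
  shows "\<bar>average h K (left_translate t g) - average h K g\<bar>
    \<le> 2 * norm g * (real (card (K - (*) t ` K)) / real (card K))"
proof -
  let ?g = "\<lambda>x. apply_bcontfun g (discrete (h x))"
  obtain P where P: "P \<subseteq> K" "inj_on ((*) t) P" "(*) t ` P = K \<inter> (*) t ` K"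
  proof -
    obtain Q where "Q \<subseteq> K" "inj_on ((*) t) Q" "(*) t ` Q = (*) t ` K"
      using inj_on_transversal[OF K] by metis
    then show ?thesis
      by (intro that[of "{x\<in>Q. t * x \<in> K}"]) (auto simp: inj_on_def set_eq_iff image_iff, metis+)
  qed
  have "card P = card (K \<inter> (*) t ` K)"
    using P by (metis card_image)
  then have cP: "card (K - P) = card (K - (*) t ` K)"
    using P K by (simp add: card_Diff_subset finite_subset card_Diff_subset_Int)
  have bound: "\<bar>\<Sum>x\<in>B. ?g (k x)\<bar> \<le> norm g * real (card B)" for B and k :: "'a \<Rightarrow> 'a"
    using sum_norm_le[of B "\<lambda>x. ?g (k x)" "\<lambda>_. norm g"] norm_bounded[of g] by (simp add: mult.commute)
  have "(\<Sum>x\<in>K. ?g (t * x)) = (\<Sum>x\<in>K - P. ?g (t * x)) + (\<Sum>x\<in>P. ?g (t * x))"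
    using K P by (intro sum.subset_diff) auto
  also have "(\<Sum>x\<in>P. ?g (t * x)) = (\<Sum>x\<in>K \<inter> (*) t ` K. ?g x)"
    using P by (simp add: sum.reindex flip: P(3))
  also have "\<dots> = (\<Sum>x\<in>K. ?g x) - (\<Sum>x\<in>K - (*) t ` K. ?g x)"
    using K by (simp add: sum.Int_Diff[of K ?g "(*) t ` K"])
  finally have "\<bar>(\<Sum>x\<in>K. ?g (t * x)) - (\<Sum>x\<in>K. ?g x)\<bar> \<le> 2 * (norm g * card (K - (*) t ` K))"
    using bound[of "\<lambda>x. t * x" "K - P"] bound[of "\<lambda>x. x" "K - (*) t ` K"] unfolding cP by linarith
  then have "\<bar>(\<Sum>x\<in>K. ?g (t * x)) - (\<Sum>x\<in>K. ?g x)\<bar> / card K \<le> 2 * (norm g * card (K - (*) t ` K)) / card K"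
    by (rule divide_right_mono) simp
  then show ?thesis
    by (simp add: average_def left_translate.rep_eq h discrete_inverse abs_divide mult.assoc flip: diff_divide_distrib)
qed

lemma closed_Collect_ball:
  "(\<And>x. x \<in> B \<Longrightarrow> closed {y. P x y}) \<Longrightarrow> closed {y. \<forall>x\<in>B. P x y}"
  by (simp add: Collect_ball_eq closed_INT)

text \<open>Tychonoff compactness: averages satisfy any finitely many approximate invariance
  conditions, and a functional satisfying all of them is an invariant mean.\<close>

lemma exists_left_invariant_mean:
  fixes A :: "'a::semigroup_mult set"
  assumes ex: "\<And>(H :: 'a set) \<epsilon>. finite H \<Longrightarrow> \<epsilon> > 0 \<Longrightarrow>
    \<exists>K h. finite K \<and> K \<noteq> {} \<and> (\<forall>t\<in>H. real (card (K - (*) t ` K)) < \<epsilon> * real (card K)) \<and>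
      (\<forall>t x. h (t * x) = t * h x) \<and> \<alpha> * real (card K) \<le> real (card {x\<in>K. h x \<in> A})"
  shows "\<exists>\<mu>\<in>left_invariant_means. \<alpha> \<le> \<mu> (char_fun A)"
proof -
  define X :: "('a linf \<Rightarrow> real) set" where "X = Pi\<^sub>E UNIV (\<lambda>g. {- norm g..norm g})"
  define I :: "('a set \<times> real) set" where "I = {(H, \<epsilon>). finite H \<and> 0 < \<epsilon>}"
  \<comment> \<open>Every condition is an intersection of closed conditions on finitely many
    coordinates \<open>\<mu> g\<close>, so \<open>C\<close> is closed for pointwise
    convergence.\<close>
  define C :: "'a set \<times> real \<Rightarrow> ('a linf \<Rightarrow> real) set" where "C = (\<lambda>(H, \<epsilon>). {\<mu>.
     (\<forall>f g. \<mu> (f + g) = \<mu> f + \<mu> g) \<and> (\<forall>r g. \<mu> (r *\<^sub>R g) = r * \<mu> g) \<and>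
     (\<forall>g\<in>{g. \<forall>x. 0 \<le> apply_bcontfun g x}. 0 \<le> \<mu> g) \<and> \<mu> (const_bcontfun 1) = 1 \<and>
     \<alpha> \<le> \<mu> (char_fun A) \<and> (\<forall>t\<in>H. \<forall>g. \<bar>\<mu> (left_translate t g) - \<mu> g\<bar> \<le> 2 * norm g * \<epsilon>)})"
  have "compactin euclidean X"
    unfolding X_def
    by (subst euclidean_product_topology[symmetric]) (simp add: compactin_PiE)
  then have compact: "compact X"
    by simp
  have closed: "closed (C i)" for i
    unfolding C_def case_prod_beta
    by (intro closed_Collect_conj closed_Collect_all closed_Collect_ball closed_Collect_eq
        closed_Collect_le continuous_intros continuous_on_product_coordinates)
  have fip: "X \<inter> (\<Inter>i\<in>J. C i) \<noteq> {}" if J: "finite J" "J \<subseteq> I" for J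
  proof -
    \<comment> \<open>Inserting 1 gives a positive minimum even for empty \<open>J\<close>.\<close>
    define \<epsilon> where "\<epsilon> = Min (insert 1 (snd ` J))"
    have \<epsilon>: "\<epsilon> > 0" "\<And>i. i \<in> J \<Longrightarrow> \<epsilon> \<le> snd i"
      using J by (auto simp: \<epsilon>_def I_def)
    have "finite (\<Union>i\<in>J. fst i)"
      using J by (auto simp: I_def)
    from ex[OF this \<epsilon>(1)] obtain K h where K: "finite K" "K \<noteq> {}"
      and small: "\<forall>t\<in>(\<Union>i\<in>J. fst i). real (card (K - (*) t ` K)) < \<epsilon> * real (card K)"
      and h: "\<forall>t x. h (t * x) = t * h x"
      and A: "\<alpha> * real (card K) \<le> real (card {x\<in>K. h x \<in> A})"
      by (elim exE conjE)
    have pos: "real (card K) > 0"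
      using K by (simp add: card_gt_0_iff)
    have "average h K \<in> X"
    proof -
      have "\<bar>average h K g\<bar> \<le> norm g" for g
        using sum_norm_le[of K "\<lambda>x. apply_bcontfun g (discrete (h x))" "\<lambda>_. norm g"] norm_bounded[of g] pos
        by (simp add: average_def divide_le_eq mult.commute)
      then show ?thesis
        by (auto simp: X_def abs_le_iff) (metis minus_le_iff)
    qed
    moreover have "average h K \<in> C i" if "i \<in> J" for i
    proof -
      have "\<bar>average h K (left_translate t g) - average h K g\<bar> \<le> 2 * norm g * snd i"
        if "t \<in> fst i" for t g
      proof (rule order_trans[OF average_left_translate_le[OF K(1)]])
        have "real (card (K - (*) t ` K)) / real (card K) < \<epsilon>"
          using small \<open>i \<in> J\<close> that pos by (auto simp: divide_less_eq)
        then show "2 * norm g * (real (card (K - (*) t ` K)) / real (card K)) \<le> 2 * norm g * snd i"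
          using \<epsilon>(2)[OF \<open>i \<in> J\<close>] by (intro mult_left_mono) auto
      qed (use h in blast)
      moreover have "\<alpha> \<le> average h K (char_fun A)"
        using A K(1) pos
        by (simp add: average_def char_fun.rep_eq discrete_inverse indicator_def sum.If_cases Int_def le_divide_eq)
      ultimately show ?thesis
        using pos by (auto simp: C_def average_def case_prod_beta sum.distrib add_divide_distrib
            sum_distrib_left[symmetric] intro!: divide_nonneg_nonneg sum_nonneg)
    qed
    ultimately show ?thesis
      by blast
  qed
  have "X \<inter> (\<Inter>i\<in>I. C i) \<noteq> {}"
    by (rule compact_imp_fip_image[OF compact closed fip])
  then obtain \<mu> where X: "\<mu> \<in> X" and C: "\<And>H \<epsilon>. finite H \<Longrightarrow> \<epsilon> > 0 \<Longrightarrow> \<mu> \<in> C (H, \<epsilon>)"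
    by (auto simp: I_def)
  have C1: "\<mu> \<in> C ({}, 1)"
    by (rule C) auto
  have bound: "norm (\<mu> g) \<le> norm g" for g
    using X by (auto simp: X_def PiE_iff abs_le_iff minus_le_iff)
  have lin: "bounded_linear \<mu>"
    by (rule bounded_linear_intro[of _ 1]) (use C1 bound in \<open>auto simp: C_def\<close>)
  have "\<mu> (left_translate t g) = \<mu> g" for t g
  proof -
    have "\<bar>\<mu> (left_translate t g) - \<mu> g\<bar> \<le> e" if "e > 0" for e
    proof -
      \<comment> \<open>The summand 1 keeps the denominator positive when
        \<open>norm g = 0\<close>.\<close>
      define \<epsilon> where "\<epsilon> = e / (2 * norm g + 1)"
      have "\<epsilon> > 0"
        using that by (simp add: \<epsilon>_def add_nonneg_pos)
      then have "\<bar>\<mu> (left_translate t g) - \<mu> g\<bar> \<le> 2 * norm g * \<epsilon>"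
        using C[of "{t}" \<epsilon>] by (auto simp: C_def)
      also have "\<dots> \<le> (2 * norm g + 1) * \<epsilon>"
        using \<open>\<epsilon> > 0\<close> by simp
      also have "\<dots> = e"
      proof -
        have "2 * norm g + 1 \<noteq> 0"
          using norm_ge_zero[of g] by linarith
        then show ?thesis
          by (simp add: \<epsilon>_def)
      qed
      finally show ?thesis .
    qed
    then show ?thesis
      using field_le_epsilon[of "\<bar>\<mu> (left_translate t g) - \<mu> g\<bar>" 0] by simp
  qed
  moreover have "is_mean \<mu>"
  proof -
    have "onorm \<mu> \<le> 1"
      using bound by (intro onorm_bound) auto
    moreover have "1 \<le> onorm \<mu>"
    proof -
      have "norm (const_bcontfun 1 :: 'a linf) \<le> 1"
        by (rule norm_bound) simp
      moreover have "1 \<le> onorm \<mu> * norm (const_bcontfun 1 :: 'a linf)"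
        using onorm[OF lin, of "const_bcontfun 1"] C1 by (simp add: C_def)
      ultimately show ?thesis
        using onorm_pos_le[OF lin] mult_left_mono[of "norm (const_bcontfun 1 :: 'a linf)" 1 "onorm \<mu>"]
        by linarith
    qed
    ultimately show ?thesis
      using lin C1 by (simp add: is_mean_def C_def)
  qed
  moreover have "\<alpha> \<le> \<mu> (char_fun A)"
    using C1 by (simp add: C_def)
  ultimately show ?thesis
    by (auto simp: left_invariant_means_def)
qed

section \<open>Comparison of the densities and the limit of the maxima\<close>

text \<open>Ensures that the \<open>MAX\<close> over a possibly infinite semigroup is an attained
  maximum.\<close>

lemma finite_range_card_ratio:
  assumes B: "finite B"
  shows "finite (range (\<lambda>s. real (card (Q s \<inter> B)) / real (card B)))"
proof -
  have "range (\<lambda>s. real (card (Q s \<inter> B)) / real (card B)) \<subseteq> (\<lambda>n. real n / real (card B)) ` {..card B}"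
    using B by (auto intro: card_mono)
  then show ?thesis
    by (rule finite_subset) simp
qed

theorem theorem5p3:
  fixes D :: "'d set" and le :: "'d \<Rightarrow> 'd \<Rightarrow> bool"
    and F :: "'d \<Rightarrow> 'a::semigroup_mult set"
  assumes "strong_folner_condition TYPE('a)"
    and "folner_net D le F"
  shows "\<forall>A :: 'a set.
    folner_density A = mean_density A \<and>
    mean_density A = translate_density A \<and>
    ((\<lambda>\<alpha>. MAX s\<in>(UNIV :: 'a set). real (card (right_quotient A s \<inter> F \<alpha>)) / real (card (F \<alpha>)))
       \<longlongrightarrow> translate_density A) (net_filter D le)"
proof (rule allI)
  fix A :: "'a set"
  note sfc = assms(1)
  have dir: "directed_set D le"
    and F: "\<And>\<alpha>. \<alpha> \<in> D \<Longrightarrow> finite (F \<alpha>) \<and> F \<alpha> \<noteq> {}"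
    and lim: "\<And>s. ((\<lambda>\<alpha>. real (card (F \<alpha> - (*) s ` F \<alpha>)) / real (card (F \<alpha>))) \<longlongrightarrow> 0) (net_filter D le)"
    using assms(2) by (auto simp: folner_net_def)
  let ?LIM = "left_invariant_means :: ('a linf \<Rightarrow> real) set"
  define T where "T = {\<alpha>::real\<in>{0..1}. \<forall>F. finite F \<and> F \<noteq> {} \<longrightarrow>
    (\<exists>s. real (card (F \<inter> right_quotient A s)) \<ge> \<alpha> * real (card F))}"
  define L where "L = {\<alpha>::real\<in>{0..1}. \<forall>H. \<forall>\<epsilon>>0. finite H \<and> H \<noteq> {} \<longrightarrow>
    (\<exists>K. finite K \<and> K \<noteq> {} \<and> (\<forall>s\<in>H. real (card (K - (*) s ` K)) < \<epsilon> * real (card K)) \<and>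
      real (card (A \<inter> K)) \<ge> \<alpha> * real (card K))}"
  have T: "translate_density A = Sup T" "bdd_above T" "0 \<in> T"
    by (auto simp: T_def translate_density_def)
  have "0 \<in> L"
    unfolding L_def using strong_folner_conditionE[OF sfc] by simp metis
  then have L: "folner_density A = Sup L" "bdd_above L" "0 \<in> L"
    by (auto simp: L_def folner_density_def)
  have mean01: "0 \<le> \<mu> (char_fun A)" "\<mu> (char_fun A) \<le> 1" if "\<mu> \<in> ?LIM" for \<mu>
    using that is_mean_le[of \<mu> "char_fun A" 1]
    by (auto simp: left_invariant_means_def is_mean_def char_fun.rep_eq indicator_def)
  then have bdd: "bdd_above ((\<lambda>\<mu>. \<mu> (char_fun A)) ` ?LIM)"
    by (intro bdd_aboveI2[of _ _ 1]) auto
  have le_mean: "\<alpha> \<le> mean_density A"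
    if conv: "\<And>(H :: 'a set) \<epsilon>. finite H \<Longrightarrow> \<epsilon> > 0 \<Longrightarrow>
      \<exists>K h. finite K \<and> K \<noteq> {} \<and> (\<forall>t\<in>H. real (card (K - (*) t ` K)) < \<epsilon> * real (card K)) \<and>
        (\<forall>t x. h (t * x) = t * h x) \<and> \<alpha> * real (card K) \<le> real (card {x\<in>K. h x \<in> A})" for \<alpha>
  proof -
    obtain \<mu> where "\<mu> \<in> ?LIM" "\<alpha> \<le> \<mu> (char_fun A)"
      using exists_left_invariant_mean[OF conv] by blast
    then show ?thesis
      unfolding mean_density_def using bdd by (rule cSUP_upper2[rotated])
  qed
  \<comment> \<open>The case \<open>\<alpha> = 0\<close> shows that left invariant means exist, so
    that \<open>cSUP_least\<close> applies.\<close>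
  have "\<exists>\<mu>\<in>?LIM. 0 \<le> \<mu> (char_fun A)"
  proof (rule exists_left_invariant_mean)
    fix H :: "'a set" and \<epsilon> :: real
    assume "finite H" "\<epsilon> > 0"
    then obtain K where "finite K" "K \<noteq> {}" "\<And>s. s \<in> H \<Longrightarrow> real (card (K - (*) s ` K)) < \<epsilon> * real (card K)"
      using strong_folner_conditionE[OF sfc] by metis
    then show "\<exists>K h. finite K \<and> K \<noteq> {} \<and> (\<forall>t\<in>H. real (card (K - (*) t ` K)) < \<epsilon> * real (card K)) \<and>
        (\<forall>t x. h (t * x) = t * h x) \<and> 0 * real (card K) \<le> real (card {x\<in>K. h x \<in> A})"
      by (intro exI[of _ K] exI[of _ "\<lambda>x. x"]) auto
  qed
  then have "?LIM \<noteq> {}"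
    by blast
  have folner_le_mean: "Sup L \<le> mean_density A"
  proof (rule cSup_least)
    fix \<alpha> assume "\<alpha> \<in> L"
    show "\<alpha> \<le> mean_density A"
    proof (rule le_mean)
      fix H :: "'a set" and \<epsilon> :: real
      assume "finite H" "\<epsilon> > 0"
      then have "finite (insert undefined H)" "insert undefined H \<noteq> {}"
        by auto
      then obtain K where "finite K" "K \<noteq> {}" "\<forall>s\<in>insert undefined H. real (card (K - (*) s ` K)) < \<epsilon> * real (card K)"
        "\<alpha> * real (card K) \<le> real (card (A \<inter> K))"
        using \<open>\<alpha> \<in> L\<close> \<open>\<epsilon> > 0\<close> unfolding L_def by blast
      then show "\<exists>K h. finite K \<and> K \<noteq> {} \<and> (\<forall>t\<in>H. real (card (K - (*) t ` K)) < \<epsilon> * real (card K)) \<and>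
        (\<forall>t x. h (t * x) = t * h x) \<and> \<alpha> * real (card K) \<le> real (card {x\<in>K. h x \<in> A})"
        by (intro exI[of _ K] exI[of _ "\<lambda>x. x"]) (auto simp: Int_def conj_commute)
    qed
  qed (use L in auto)
  have mean_le_folner: "mean_density A \<le> Sup L"
    unfolding mean_density_def
  proof (rule cSUP_least[OF \<open>?LIM \<noteq> {}\<close>], rule dense_le)
    \<comment> \<open>Folner sets are available for densities strictly below the mean, hence the
      passage through \<open>c\<close>; negative \<open>c\<close> are covered by
      \<open>0 \<in> L\<close>.\<close>
    fix \<mu> c assume \<mu>: "\<mu> \<in> ?LIM" and c: "c < \<mu> (char_fun A)"
    show "c \<le> Sup L"
    proof (cases "0 \<le> c")
      case True
      then have "c \<in> L"
        using folner_set_of_mean[OF sfc \<mu> True c] mean01[OF \<mu>] c by (auto simp: L_def)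
      then show ?thesis
        using L by (simp add: cSup_upper)
    next
      case False
      then show ?thesis
        using cSup_upper[OF L(3,2)] by simp
    qed
  qed
  have translate_le_mean: "Sup T \<le> mean_density A"
  proof (rule cSup_least)
    fix \<alpha> assume "\<alpha> \<in> T"
    show "\<alpha> \<le> mean_density A"
    proof (rule le_mean)
      fix H :: "'a set" and \<epsilon> :: real
      assume "finite H" "\<epsilon> > 0"
      then obtain K where K: "finite K" "K \<noteq> {}" "\<And>s. s \<in> H \<Longrightarrow> real (card (K - (*) s ` K)) < \<epsilon> * real (card K)"
        using strong_folner_conditionE[OF sfc] by metis
      then obtain s where "\<alpha> * real (card K) \<le> real (card (K \<inter> right_quotient A s))"
        using \<open>\<alpha> \<in> T\<close> by (auto simp: T_def)
      then show "\<exists>K h. finite K \<and> K \<noteq> {} \<and> (\<forall>t\<in>H. real (card (K - (*) t ` K)) < \<epsilon> * real (card K)) \<and>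
        (\<forall>t x. h (t * x) = t * h x) \<and> \<alpha> * real (card K) \<le> real (card {x\<in>K. h x \<in> A})"
        \<comment> \<open>Associativity makes right translation by \<open>s\<close> commute with
          left translations.\<close>
        using K by (intro exI[of _ K] exI[of _ "\<lambda>x. x * s"]) (auto simp: Int_def right_quotient_def mult.assoc)
    qed
  qed (use T in auto)
  have mean_le_translate: "mean_density A \<le> Sup T"
    unfolding mean_density_def
  proof (rule cSUP_least[OF \<open>?LIM \<noteq> {}\<close>])
    fix \<mu> assume \<mu>: "\<mu> \<in> ?LIM"
    have "\<mu> (char_fun A) \<in> T"
      using mean01[OF \<mu>] left_invariant_mean_ex_translate[OF \<mu>, of _ A "\<lambda>x. x"]
      by (auto simp: T_def right_quotient_def Int_def)
    then show "\<mu> (char_fun A) \<le> Sup T"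
      using T by (simp add: cSup_upper)
  qed
  let ?r = "\<lambda>\<alpha> s. real (card (right_quotient A s \<inter> F \<alpha>)) / real (card (F \<alpha>))"
  let ?m = "\<lambda>\<alpha>. MAX s\<in>(UNIV :: 'a set). ?r \<alpha> s"
  have pos: "real (card (F \<alpha>)) > 0" if "\<alpha> \<in> D" for \<alpha>
    using F[OF that] by (simp add: card_gt_0_iff)
  have lower: "Sup T \<le> ?m \<alpha>" if "\<alpha> \<in> D" for \<alpha>
  proof (rule cSup_least)
    fix c assume "c \<in> T"
    then obtain s where "c * real (card (F \<alpha>)) \<le> real (card (F \<alpha> \<inter> right_quotient A s))"
      using F[OF \<open>\<alpha> \<in> D\<close>] by (auto simp: T_def)
    then have "c \<le> ?r \<alpha> s"
      using pos[OF \<open>\<alpha> \<in> D\<close>] by (simp add: le_divide_eq Int_commute)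
    also have "?r \<alpha> s \<le> ?m \<alpha>"
      using F[OF \<open>\<alpha> \<in> D\<close>] by (intro Max_ge finite_range_card_ratio) auto
    finally show "c \<le> ?m \<alpha>" .
  qed (use T in auto)
  have "(?m \<longlongrightarrow> Sup T) (net_filter D le)"
  proof (rule order_tendstoI)
    fix c assume "c < Sup T"
    moreover obtain a where "a \<in> D"
      using dir by (auto simp: directed_set_def)
    ultimately show "\<forall>\<^sub>F \<alpha> in net_filter D le. c < ?m \<alpha>"
      using lower by (force simp: eventually_net_filter[OF dir])
  next
    fix c assume "Sup T < c"
    show "\<forall>\<^sub>F \<alpha> in net_filter D le. ?m \<alpha> < c"
    proof (rule ccontr)
      \<comment> \<open>If the maxima are not eventually below \<open>c\<close>, they reach
        \<open>c\<close> beyond every index, in particular where \<open>F \<alpha>\<close> is almost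
        invariant under \<open>H\<close>. Right translation by a maximizing \<open>s\<close> then
        serves as \<open>h\<close>.\<close>
      assume no: "\<not> ?thesis"
      have "c \<le> mean_density A"
      proof (rule le_mean)
        fix H :: "'a set" and \<epsilon> :: real
        assume "finite H" "\<epsilon> > 0"
        then have "\<forall>\<^sub>F \<alpha> in net_filter D le. \<forall>t\<in>H. real (card (F \<alpha> - (*) t ` F \<alpha>)) / real (card (F \<alpha>)) < \<epsilon>"
          by (intro eventually_ball_finite ballI order_tendstoD(2)[OF lim])
        then obtain \<alpha> where \<alpha>: "\<alpha> \<in> D" "c \<le> ?m \<alpha>"
          and small: "\<And>t. t \<in> H \<Longrightarrow> real (card (F \<alpha> - (*) t ` F \<alpha>)) / real (card (F \<alpha>)) < \<epsilon>"
          using no by (auto simp: eventually_net_filter[OF dir] not_less)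
        have "?m \<alpha> \<in> range (?r \<alpha>)"
          using F[OF \<alpha>(1)] by (intro Max_in finite_range_card_ratio) auto
        then obtain s where "c \<le> ?r \<alpha> s"
          using \<alpha>(2) by auto
        then show "\<exists>K h. finite K \<and> K \<noteq> {} \<and> (\<forall>t\<in>H. real (card (K - (*) t ` K)) < \<epsilon> * real (card K)) \<and>
          (\<forall>t x. h (t * x) = t * h x) \<and> c * real (card K) \<le> real (card {x\<in>K. h x \<in> A})"
          using F[OF \<alpha>(1)] pos[OF \<alpha>(1)] small
          by (intro exI[of _ "F \<alpha>"] exI[of _ "\<lambda>x. x * s"])
            (auto simp: right_quotient_def Int_def mult.assoc le_divide_eq divide_less_eq conj_commute)
      qed
      then show False
        using mean_le_translate \<open>Sup T < c\<close> by simp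
    qed
  qed
  then show "folner_density A = mean_density A \<and> mean_density A = translate_density A \<and>
      (?m \<longlongrightarrow> translate_density A) (net_filter D le)"
    using folner_le_mean mean_le_folner translate_le_mean mean_le_translate L(1) T(1) by simp
qed

end
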